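(* Let $q\ge 3$ be a prime power, let $q^{-1}<s<1$, and let $s_R,s_{A+R}\in(q^{-1},1]$ be desired sparsity levels such that at least one conditional PMF of the form described in the context attains $\Pr(R=0)=s_R$ and $\Pr(A+R=0)=s_{A+R}$. Put $$\theta=\frac{(q-2)^2}{q-1},\qquad \alpha=s^2(4+\theta),\qquad \delta=-\theta\, s_{A+R}\,s_R,$$ $$\beta=4s(1-s-s_{A+R}-s_R)-\theta s(s_R+s_{A+R}+s),$$ $$\gamma=(1-s-s_{A+R}-s_R)^2+\theta(s\,s_{A+R}+s\,s_R+s_{A+R}\,s_R).$$ Then, among all conditional PMFs of the form described in the context that satisfy $\Pr(R=0)=s_R$ and $\Pr(A+R=0)=s_{A+R}$, the one that minimizes the total leakage $\mathrm{I}_q(A;R)+\mathrm{I}_q(A;A+R)$ is obtained by setting $p_1=p_1^\star$, where $p_1^\star$ is the root of the polynomial $$\alpha p_1^3+\beta p_1^2+\gamma p_1+\delta$$ that satisfies $$\max\{s_R+s_{A+R}-1+s,\,0\}\le 2p_1 s\le 2\min\{s,s_R,s_{A+R}\},$$ and by determining the remaining parameters $p_1^{\mathrm{inv}},p_2,p_3,p_{2,3}^{\mathrm{inv}}$ from $p_1=p_1^\star$ through the linear equations $$p_1+(q-1)p_1^{\mathrm{inv}}=1,\qquad p_2+p_3+(q-2)p_{2,3}^{\mathrm{inv}}=1,$$ $$p_1 s+p_2(1-s)=s_R,\qquad p_1 s+p_3(1-s)=s_{A+R}.$$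
   Context: $\mathbb{F}_q$ is the finite field with $q$ elements and $\mathbb{F}_q^*=\mathbb{F}_q\setminus\{0\}$. $A$ is an $\mathbb{F}_q$-valued random variable (one entry of the private matrix) with $\Pr(A=0)=s$ and $\Pr(A=a)=\frac{1-s}{q-1}$ for every $a\in\mathbb{F}_q^*$. The $\mathbb{F}_q$-valued random variable $R$ (the corresponding entry of the padding matrix) is drawn conditionally on $A$ according to a conditional PMF of the following form, with parameters $p_1,p_1^{\mathrm{inv}},p_2,p_3,p_{2,3}^{\mathrm{inv}}\in[0,1]$: $$\Pr(R=x\mid A=0)=\begin{cases}p_1,&x=0\\ p_1^{\mathrm{inv}},&x\ne 0,\end{cases}$$ and, for every $a\in\mathbb{F}_q^*$, $$\Pr(R=x\mid A=a)=\begin{cases}p_2,&x=0\\ p_3,&x=-a\\ p_{2,3}^{\mathrm{inv}},&x\notin\{0,-a\},\end{cases}$$ where $p_1^{\mathrm{inv}}=(1-p_1)/(q-1)$ and $p_{2,3}^{\mathrm{inv}}=(1-p_2-p_3)/(q-2)$. $\mathrm{I}_q$ denotes mutual information computed with logarithms to base $q$ (with $0\log 0=0$), and $A+R$ is addition in $\mathbb{F}_q$. *)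

theory Defs
  imports "HOL-Probability.Probability"
begin

definition joint_pmf :: "'f pmf \<Rightarrow> ('f \<Rightarrow> 'f pmf) \<Rightarrow> ('f \<times> 'f) pmf" where
  "joint_pmf A W = bind_pmf A (\<lambda>a. map_pmf (\<lambda>x. (a, x)) (W a))"

(* On the joint law of (A, R), the random variables A, R and A + R are
   fst, snd and \<lambda>(a, x). a + x. *)
lemma pmf_joint_pmf: "pmf (joint_pmf A W) (a, x) = pmf A a * pmf (W a) x"
proof -
  have *: "pmf (map_pmf (\<lambda>x. (b, x)) (W b)) (a, x) = indicator {a} b * pmf (W a) x" for b
  proof (cases "b = a")
    case True
    then show ?thesis
      using pmf_map_inj'[of "\<lambda>x. (a, x)" "W a" x] by (simp add: inj_on_def)
  next
    case False
    then show ?thesis by (auto simp: pmf_eq_0_set_pmf)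
  qed
  show ?thesis
    by (simp add: joint_pmf_def pmf_bind * measure_pmf_single)
qed

definition private_entry_law :: "real \<Rightarrow> 'f::{field,finite} pmf \<Rightarrow> bool" where
  "private_entry_law s A \<longleftrightarrow>
     (\<forall>a. pmf A a = (if a = 0 then s else (1 - s) / (real CARD('f) - 1)))"

definition padding_kernel_with ::
    "real \<Rightarrow> real \<Rightarrow> real \<Rightarrow> real \<Rightarrow> real \<Rightarrow> ('f::{field,finite} \<Rightarrow> 'f pmf) \<Rightarrow> bool" where
  "padding_kernel_with p1 p1inv p2 p3 p23inv W \<longleftrightarrow>
     {p1, p1inv, p2, p3, p23inv} \<subseteq> {0..1} \<and>
     p1inv = (1 - p1) / (real CARD('f) - 1) \<and>
     p23inv = (1 - p2 - p3) / (real CARD('f) - 2) \<and>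
     (\<forall>x. pmf (W 0) x = (if x = 0 then p1 else p1inv)) \<and>
     (\<forall>a x. a \<noteq> 0 \<longrightarrow>
        pmf (W a) x = (if x = 0 then p2 else if x = - a then p3 else p23inv))"

definition padding_kernel :: "('f::{field,finite} \<Rightarrow> 'f pmf) \<Rightarrow> bool" where
  "padding_kernel W \<longleftrightarrow>
     (\<exists>p1 p1inv p2 p3 p23inv. padding_kernel_with p1 p1inv p2 p3 p23inv W)"

definition attains_sparsity ::
    "'f::{field,finite} pmf \<Rightarrow> real \<Rightarrow> real \<Rightarrow> ('f \<Rightarrow> 'f pmf) \<Rightarrow> bool" where
  "attains_sparsity A sR sAR W \<longleftrightarrow>
     measure_pmf.prob (joint_pmf A W) {(a, x). x = 0} = sR \<and>
     measure_pmf.prob (joint_pmf A W) {(a, x). a + x = 0} = sAR"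

definition total_leakage :: "'f::{field,finite} pmf \<Rightarrow> ('f \<Rightarrow> 'f pmf) \<Rightarrow> real" where
  "total_leakage A W =
     prob_space.mutual_information (measure_pmf (joint_pmf A W)) (real CARD('f))
       (count_space UNIV) (count_space UNIV) fst snd +
     prob_space.mutual_information (measure_pmf (joint_pmf A W)) (real CARD('f))
       (count_space UNIV) (count_space UNIV) fst (\<lambda>(a, x). a + x)"

end

theory Submission
  imports Defs
begin

text \<open>The sparsity constraints fix the laws of \<open>A\<close>, \<open>R\<close> and \<open>A + R\<close>, and \<open>(A, A + R)\<close> has the
  same entropy as \<open>(A, R)\<close>, so minimizing the total leakage means maximizing the joint entropy of
  \<open>(A, R)\<close>. The probabilities of this joint law are affine in \<open>t = p1 * s\<close>, and \<open>s\<close> times the cubic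
  is the difference of the two sides of the exponentiated stationarity condition
  \<open>t (c + 2t)\<^sup>2 = \<theta> (s - t) (s\<^sub>R - t) (s\<^sub>A\<^sub>R - t)\<close> with \<open>c = 1 - s - s\<^sub>R - s\<^sub>A\<^sub>R\<close>. On the feasible interval the
  left side increases and the right side decreases, which gives a unique root. At an interior root
  Gibbs' inequality shows that the entropy is strictly maximal; the root is on the boundary
  only if the interval is a single point.\<close>

section \<open>Finite sums, entropy and mutual information of finite laws\<close>

lemma sum_if_one:
  fixes u :: "'a::finite" and b c :: real
  shows "(\<Sum>x\<in>UNIV. if x = u then b else c) = b + (real CARD('a) - 1) * c"
proof -
  have "(\<Sum>x\<in>UNIV. if x = u then b else c) = (\<Sum>x\<in>UNIV. c + (if x = u then b - c else 0))"
    by (intro sum.cong) auto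
  also have "\<dots> = real CARD('a) * c + (b - c)"
    by (simp add: sum.distrib)
  finally show ?thesis by (simp add: algebra_simps)
qed

lemma sum_if_two:
  fixes u v :: "'a::finite" and b c d :: real
  assumes "u \<noteq> v"
  shows "(\<Sum>x\<in>UNIV. if x = u then b else if x = v then c else d)
    = b + c + (real CARD('a) - 2) * d"
proof -
  have "(\<Sum>x\<in>UNIV. if x = u then b else if x = v then c else d)
     = (\<Sum>x\<in>UNIV. d + (if x = u then b - d else 0) + (if x = v then c - d else 0))"
    using assms by (intro sum.cong) auto
  also have "\<dots> = real CARD('a) * d + (b - d) + (c - d)"
    by (simp add: sum.distrib)
  finally show ?thesis by (simp add: algebra_simps)
qed

text \<open>The convention \<open>0 * log 0 = 0\<close> is automatic, because the factor
  \<open>0\<close> absorbs any value of \<open>ln 0\<close>. Natural logarithms suffice: the base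
  enters later as one division by \<open>ln b\<close>.\<close>

definition neg_entropy :: "'a::finite pmf \<Rightarrow> real" where
  "neg_entropy p = (\<Sum>x\<in>UNIV. pmf p x * ln (pmf p x))"

lemma neg_entropy_two_values:
  fixes p :: "'a::finite pmf"
  assumes "\<And>x. pmf p x = (if x = a then b else c)"
  shows "neg_entropy p = b * ln b + (real CARD('a) - 1) * (c * ln c)"
proof -
  have "neg_entropy p = (\<Sum>x\<in>UNIV. if x = a then b * ln b else c * ln c)"
    unfolding neg_entropy_def by (intro sum.cong) (auto simp: assms)
  then show ?thesis by (simp only: sum_if_one)
qed

text \<open>Points outside the range of \<open>f\<close> have mass zero and contribute nothing. The
  case of interest is the shear \<open>(a, x)\<close> to \<open>(a, a + x)\<close>.\<close>

lemma neg_entropy_map_inj: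
  fixes p :: "'a::finite pmf" and f :: "'a \<Rightarrow> 'b::finite"
  assumes "inj f"
  shows "neg_entropy (map_pmf f p) = neg_entropy p"
proof -
  have "neg_entropy (map_pmf f p)
      = (\<Sum>y\<in>range f. pmf (map_pmf f p) y * ln (pmf (map_pmf f p) y))"
    unfolding neg_entropy_def
    by (intro sum.mono_neutral_right) (auto simp: pmf_eq_0_set_pmf)
  also have "\<dots> = neg_entropy p"
    unfolding neg_entropy_def
    using assms by (simp add: sum.reindex pmf_map_inj')
  finally show ?thesis .
qed

lemma pmf_map_fst_finite:
  fixes p :: "('a::finite \<times> 'b::finite) pmf"
  shows "pmf (map_pmf fst p) x = (\<Sum>y\<in>UNIV. pmf p (x, y))"
proof -
  have "fst -` {x} = Pair x ` (UNIV :: 'b set)" by auto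
  then show ?thesis
    by (simp add: pmf_map measure_measure_pmf_finite sum.reindex inj_on_def)
qed

lemma pmf_map_snd_finite:
  fixes p :: "('a::finite \<times> 'b::finite) pmf"
  shows "pmf (map_pmf snd p) y = (\<Sum>x\<in>UNIV. pmf p (x, y))"
proof -
  have "snd -` {y} = (\<lambda>x. (x, y)) ` (UNIV :: 'a set)" by auto
  then show ?thesis
    by (simp add: pmf_map measure_measure_pmf_finite sum.reindex inj_on_def)
qed

lemma distributed_measure_pmf:
  fixes X :: "'a \<Rightarrow> 'b::finite"
  shows "distributed (measure_pmf p) (count_space UNIV) X (\<lambda>x. ennreal (pmf (map_pmf X p) x))"
proof -
  have "distr (measure_pmf p) (count_space UNIV) X = measure_pmf (map_pmf X p)"
    by (simp add: map_pmf_rep_eq)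
  then show ?thesis
    by (simp add: distributed_def measure_pmf_eq_density[symmetric])
qed

lemma sum_UNIV_prod:
  fixes f :: "'a::finite \<times> 'b::finite \<Rightarrow> 'c::comm_monoid_add"
  shows "(\<Sum>z\<in>UNIV. f z) = (\<Sum>x\<in>UNIV. \<Sum>y\<in>UNIV. f (x, y))"
  by (simp add: sum.cartesian_product)

text \<open>This is I(X;Y) = H(X) + H(Y) - H(X,Y): the logarithm of the density quotient splits into
  three terms, and summing out one coordinate turns each marginal logarithm into a marginal
  entropy.\<close>

lemma mutual_information_measure_pmf:
  fixes p :: "'a pmf" and X :: "'a \<Rightarrow> 'b::finite" and Y :: "'a \<Rightarrow> 'c::finite"
  assumes b: "1 < b"
  shows "prob_space.mutual_information (measure_pmf p) b
      (count_space UNIV) (count_space UNIV) X Y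
    = (neg_entropy (map_pmf (\<lambda>z. (X z, Y z)) p)
       - neg_entropy (map_pmf X p) - neg_entropy (map_pmf Y p)) / ln b"
proof -
  interpret information_space "measure_pmf p" b
    by unfold_locales (rule b)
  define J where "J = map_pmf (\<lambda>z. (X z, Y z)) p"
  have fstJ: "map_pmf fst J = map_pmf X p" and sndJ: "map_pmf snd J = map_pmf Y p"
    by (simp_all add: J_def map_pmf_comp)
  have cs: "count_space UNIV \<Otimes>\<^sub>M count_space UNIV = count_space (UNIV :: ('b \<times> 'c) set)"
    by (subst pair_measure_countable) auto
  have "prob_space.mutual_information (measure_pmf p) b (count_space UNIV) (count_space UNIV) X Y
    = (\<integral>z. pmf J z * log b (pmf J z /
        (pmf (map_pmf fst J) (fst z) * pmf (map_pmf snd J) (snd z)))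
        \<partial>(count_space UNIV \<Otimes>\<^sub>M count_space UNIV))"
    unfolding fstJ sndJ
    by (rule mutual_information_distr)
       (auto simp: J_def distributed_measure_pmf cs sigma_finite_measure_count_space_finite)
  also have "\<dots> = (\<Sum>z\<in>UNIV. pmf J z * log b (pmf J z /
      (pmf (map_pmf fst J) (fst z) * pmf (map_pmf snd J) (snd z))))"
    by (simp add: cs lebesgue_integral_count_space_finite split_beta)
  also have "\<dots> = (\<Sum>z\<in>UNIV. pmf J z * ln (pmf J z)
      - pmf J z * ln (pmf (map_pmf fst J) (fst z))
      - pmf J z * ln (pmf (map_pmf snd J) (snd z))) / ln b"
  proof (unfold sum_divide_distrib, intro sum.cong refl)
    fix z :: "'b \<times> 'c"
    show "pmf J z * log b (pmf J z / (pmf (map_pmf fst J) (fst z) * pmf (map_pmf snd J) (snd z)))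
      = (pmf J z * ln (pmf J z) - pmf J z * ln (pmf (map_pmf fst J) (fst z))
         - pmf J z * ln (pmf (map_pmf snd J) (snd z))) / ln b"
    \<comment> \<open>On the support of \<open>J\<close> both marginals are positive, so the
      logarithm splits; elsewhere the factor \<open>pmf J z\<close> is zero.\<close>
    proof (cases "z \<in> set_pmf J")
      case True
      then have "fst z \<in> set_pmf (map_pmf fst J)" "snd z \<in> set_pmf (map_pmf snd J)" by auto
      then have "0 < pmf J z" "0 < pmf (map_pmf fst J) (fst z)" "0 < pmf (map_pmf snd J) (snd z)"
        using True by (simp_all only: pmf_positive)
      then show ?thesis
        by (simp add: log_def ln_div ln_mult field_simps)
    next
      case False
      then have "pmf J z = 0" by (simp add: set_pmf_iff)
      then show ?thesis by simp
    qed
  qed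
  also have "(\<Sum>z\<in>UNIV. pmf J z * ln (pmf J z)
      - pmf J z * ln (pmf (map_pmf fst J) (fst z))
      - pmf J z * ln (pmf (map_pmf snd J) (snd z)))
    = neg_entropy J - (\<Sum>z\<in>UNIV. pmf J z * ln (pmf (map_pmf fst J) (fst z)))
       - (\<Sum>z\<in>UNIV. pmf J z * ln (pmf (map_pmf snd J) (snd z)))"
    by (simp add: sum_subtractf neg_entropy_def)
  also have "(\<Sum>z\<in>UNIV. pmf J z * ln (pmf (map_pmf fst J) (fst z))) = neg_entropy (map_pmf fst J)"
    by (simp add: neg_entropy_def sum_UNIV_prod pmf_map_fst_finite sum_distrib_right)
  also have "(\<Sum>z\<in>UNIV. pmf J z * ln (pmf (map_pmf snd J) (snd z))) = neg_entropy (map_pmf snd J)"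
    by (simp add: neg_entropy_def sum_UNIV_prod pmf_map_snd_finite sum_distrib_right) (rule sum.swap)
  finally show ?thesis unfolding fstJ sndJ by (simp add: J_def)
qed

text \<open>The left side is the tangent at \<open>y\<close> of the strictly convex function
  \<open>x * ln x\<close>, since \<open>y * ln y + (ln y + 1) * (x - y) = x * ln y + x - y\<close>.
  The strict form yields uniqueness of the minimizer.\<close>

lemma xlnx_ge_tangent:
  fixes x y :: real
  assumes "0 \<le> x" "0 < y"
  shows "x * ln y + x - y \<le> x * ln x" and "x \<noteq> y \<Longrightarrow> x * ln y + x - y < x * ln x"
proof -
  have *: "x * ln y + x - y < x * ln x" if "x \<noteq> y"
  proof (cases "x = 0")
    case False
    then have x: "0 < x" using assms by simp
    then have "ln (y / x) < y / x - 1"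
      using assms that ln_le_minus_one[of "y / x"] ln_eq_minus_one[of "y / x"] by force
    then have "x * ln (y / x) < x * (y / x - 1)" using x by simp
    then show ?thesis using x assms by (simp add: ln_div algebra_simps)
  qed (use assms in simp)
  show "x \<noteq> y \<Longrightarrow> x * ln y + x - y < x * ln x" by (rule *)
  show "x * ln y + x - y \<le> x * ln x" using * by (cases "x = y") (auto intro: less_imp_le)
qed

section \<open>Joint law, marginals and sparsity of a padding kernel\<close>

lemma map_fst_joint_pmf: "map_pmf fst (joint_pmf A W) = A"
  by (simp add: joint_pmf_def map_bind_pmf map_pmf_comp map_pmf_const bind_return_pmf')

text \<open>The pair \<open>(A, A + R)\<close> is an injective image of \<open>(A, R)\<close>, so
  both mutual informations contain the same joint entropy; hence the factor 2.\<close>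

lemma total_leakage_neg_entropy:
  fixes A :: "'f::{field,finite} pmf"
  assumes "2 \<le> CARD('f)"
  shows "total_leakage A W =
    (2 * neg_entropy (joint_pmf A W) - 2 * neg_entropy A
     - neg_entropy (map_pmf snd (joint_pmf A W))
     - neg_entropy (map_pmf (\<lambda>(a, x). a + x) (joint_pmf A W))) / ln (real CARD('f))"
proof -
  have "inj (\<lambda>z :: 'f \<times> 'f. (fst z, case z of (a, x) \<Rightarrow> a + x))"
    by (auto simp: inj_def)
  then show ?thesis
    using assms unfolding total_leakage_def
    by (simp add: mutual_information_measure_pmf neg_entropy_map_inj map_fst_joint_pmf
        diff_divide_distrib)
qed

lemma pmf_padding_kernel:
  fixes W :: "'f::{field,finite} \<Rightarrow> 'f pmf"
  assumes "padding_kernel_with p1 p1inv p2 p3 p23inv W"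
  shows "pmf (W a) x = (if a = 0 then if x = 0 then p1 else p1inv
           else if x = 0 then p2 else if x = - a then p3 else p23inv)"
  using assms by (auto simp: padding_kernel_with_def)

lemma pmf_map_snd_joint:
  fixes A :: "'f::{field,finite} pmf"
  assumes A: "private_entry_law s A"
    and W: "padding_kernel_with p1 p1inv p2 p3 p23inv W"
    and card: "2 \<le> CARD('f)"
  shows "pmf (map_pmf snd (joint_pmf A W)) x =
    (if x = 0 then s * p1 + (1 - s) * p2
     else s * p1inv + (1 - s) / (real CARD('f) - 1) * (p3 + (real CARD('f) - 2) * p23inv))"
proof -
  let ?c = "(1 - s) / (real CARD('f) - 1)"
  have A': "pmf A a = (if a = 0 then s else ?c)" for a
    using A by (simp add: private_entry_law_def)
  have "pmf (map_pmf snd (joint_pmf A W)) x = (\<Sum>a\<in>UNIV. pmf A a * pmf (W a) x)"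
    by (simp add: pmf_map_snd_finite pmf_joint_pmf)
  \<comment> \<open>The condition \<open>x = - a\<close> is read as a condition on \<open>a\<close>:
    for fixed nonzero \<open>x\<close> exactly one row, \<open>a = - x\<close>, contributes
    \<open>p3\<close>.\<close>
  moreover have "pmf A a * pmf (W a) x = (if x = 0 then if a = 0 then s * p1 else ?c * p2
      else if a = 0 then s * p1inv else if a = - x then ?c * p3 else ?c * p23inv)" for a
    by (auto simp: A' pmf_padding_kernel[OF W])
  moreover have "(real CARD('f) - 1) * ?c = 1 - s"
    using card by simp
  then have "(real CARD('f) - 1) * (?c * p2) = (1 - s) * p2"
    by (metis mult.assoc)
  moreover have "(\<Sum>a\<in>UNIV. if a = 0 then s * p1inv else if a = - x then ?c * p3 else ?c * p23inv)
      = s * p1inv + ?c * (p3 + (real CARD('f) - 2) * p23inv)" if "x \<noteq> 0"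
    using that by (subst sum_if_two) (simp_all add: distrib_left)
  ultimately show ?thesis
    by (cases "x = 0") (simp_all only: sum_if_one simp_thms if_True if_False)
qed

text \<open>Put \<open>x = y - a\<close>. Then \<open>x = 0\<close> means \<open>a = y\<close>, and
  \<open>x = - a\<close> means \<open>y = 0\<close>, so \<open>p2\<close> and \<open>p3\<close>
  exchange the roles they have in the law of \<open>R\<close>.\<close>

lemma pmf_map_plus_joint:
  fixes A :: "'f::{field,finite} pmf"
  assumes A: "private_entry_law s A"
    and W: "padding_kernel_with p1 p1inv p2 p3 p23inv W"
    and card: "2 \<le> CARD('f)"
  shows "pmf (map_pmf (\<lambda>(a, x). a + x) (joint_pmf A W)) y =
    (if y = 0 then s * p1 + (1 - s) * p3
     else s * p1inv + (1 - s) / (real CARD('f) - 1) * (p2 + (real CARD('f) - 2) * p23inv))"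
proof -
  let ?c = "(1 - s) / (real CARD('f) - 1)"
  have A': "pmf A a = (if a = 0 then s else ?c)" for a
    using A by (simp add: private_entry_law_def)
  have fib: "(\<lambda>(a, x). a + x) -` {y} = (\<lambda>a. (a, y - a)) ` UNIV"
    by (auto simp: algebra_simps)
  have "pmf (map_pmf (\<lambda>(a, x). a + x) (joint_pmf A W)) y
      = (\<Sum>a\<in>UNIV. pmf A a * pmf (W a) (y - a))"
    by (simp add: pmf_map fib measure_measure_pmf_finite sum.reindex inj_on_def pmf_joint_pmf)
  moreover have "pmf A a * pmf (W a) (y - a) = (if y = 0 then if a = 0 then s * p1 else ?c * p3
      else if a = 0 then s * p1inv else if a = y then ?c * p2 else ?c * p23inv)" for a
    by (auto simp: A' pmf_padding_kernel[OF W])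
  moreover have "(real CARD('f) - 1) * ?c = 1 - s"
    using card by simp
  then have "(real CARD('f) - 1) * (?c * p3) = (1 - s) * p3"
    by (metis mult.assoc)
  moreover have "(\<Sum>a\<in>UNIV. if a = 0 then s * p1inv else if a = y then ?c * p2 else ?c * p23inv)
      = s * p1inv + ?c * (p2 + (real CARD('f) - 2) * p23inv)" if "y \<noteq> 0"
    using that by (subst sum_if_two) (simp_all add: distrib_left)
  ultimately show ?thesis
    by (cases "y = 0") (simp_all only: sum_if_one simp_thms if_True if_False)
qed

lemma attains_sparsity_padding_kernel:
  fixes A :: "'f::{field,finite} pmf"
  assumes "private_entry_law s A" "padding_kernel_with p1 p1inv p2 p3 p23inv W"
    and "2 \<le> CARD('f)"
  shows "attains_sparsity A sR sAR W \<longleftrightarrow>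
    p1 * s + p2 * (1 - s) = sR \<and> p1 * s + p3 * (1 - s) = sAR"
proof -
  have "measure_pmf.prob (joint_pmf A W) {(a, x). x = 0} = pmf (map_pmf snd (joint_pmf A W)) 0"
    unfolding pmf_map by (intro arg_cong[where f = "measure_pmf.prob _"]) auto
  moreover have "measure_pmf.prob (joint_pmf A W) {(a, x). a + x = 0}
      = pmf (map_pmf (\<lambda>(a, x). a + x) (joint_pmf A W)) 0"
    unfolding pmf_map by (intro arg_cong[where f = "measure_pmf.prob _"]) auto
  ultimately show ?thesis
    unfolding attains_sparsity_def pmf_map_snd_joint[OF assms] pmf_map_plus_joint[OF assms]
    by (simp add: mult.commute)
qed

text \<open>The joint law has five kinds of cells: \<open>(0, 0)\<close>, the \<open>n\<close> other
  cells of row \<open>0\<close>, and in each of the \<open>n\<close> remaining rows one cell for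
  \<open>p2\<close>, one for \<open>p3\<close> and \<open>n - 1\<close> for
  \<open>p23inv\<close>.\<close>

lemma neg_entropy_joint_padding:
  fixes A :: "'f::{field,finite} pmf" and h :: "real \<Rightarrow> real"
  defines "h \<equiv> \<lambda>x. x * ln x" and "n \<equiv> real CARD('f) - 1"
  assumes A: "private_entry_law s A"
    and W: "padding_kernel_with p1 p1inv p2 p3 p23inv W"
  shows "neg_entropy (joint_pmf A W) =
    h (s * p1) + n * h (s * p1inv)
    + n * (h ((1 - s) / n * p2) + h ((1 - s) / n * p3) + (n - 1) * h ((1 - s) / n * p23inv))"
proof -
  have A': "pmf A a = (if a = 0 then s else (1 - s) / n)" for a
    using A by (simp add: private_entry_law_def n_def)
  have row: "(\<Sum>x\<in>UNIV. h (pmf A a * pmf (W a) x)) = (if a = 0 then h (s * p1) + n * h (s * p1inv)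
     else h ((1 - s) / n * p2) + h ((1 - s) / n * p3) + (n - 1) * h ((1 - s) / n * p23inv))" for a
  proof (cases "a = 0")
    case True
    then have "(\<Sum>x\<in>UNIV. h (pmf A a * pmf (W a) x))
        = (\<Sum>x\<in>UNIV. if x = (0::'f) then h (s * p1) else h (s * p1inv))"
      by (intro sum.cong) (auto simp: A' pmf_padding_kernel[OF W])
    then show ?thesis using True by (simp add: sum_if_one n_def)
  next
    case False
    then have "(\<Sum>x\<in>UNIV. h (pmf A a * pmf (W a) x))
        = (\<Sum>x\<in>UNIV. if x = (0::'f) then h ((1 - s) / n * p2)
             else if x = - a then h ((1 - s) / n * p3) else h ((1 - s) / n * p23inv))"
      by (intro sum.cong) (auto simp: A' pmf_padding_kernel[OF W])
    then show ?thesis using False by (simp add: sum_if_two n_def)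
  qed
  have "neg_entropy (joint_pmf A W) = (\<Sum>a\<in>UNIV. \<Sum>x\<in>UNIV. h (pmf A a * pmf (W a) x))"
    by (simp add: neg_entropy_def sum_UNIV_prod pmf_joint_pmf h_def)
  then show ?thesis
    by (simp add: row sum_if_one n_def)
qed

text \<open>The formulas for \<open>p1inv\<close> and \<open>p23inv\<close> make every row sum to
  one; with at least three field elements both denominators are nonzero.\<close>

lemma exists_padding_kernel:
  fixes p1 p1inv p2 p3 p23inv :: real
  assumes card: "3 \<le> CARD('f::{field,finite})"
    and box: "{p1, p1inv, p2, p3, p23inv} \<subseteq> {0..1}"
    and p1inv: "p1inv = (1 - p1) / (real CARD('f) - 1)"
    and p23inv: "p23inv = (1 - p2 - p3) / (real CARD('f) - 2)"
  shows "\<exists>W :: 'f \<Rightarrow> 'f pmf. padding_kernel_with p1 p1inv p2 p3 p23inv W"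
proof -
  define w :: "'f \<Rightarrow> 'f \<Rightarrow> real" where
    "w a x = (if a = 0 then if x = 0 then p1 else p1inv
           else if x = 0 then p2 else if x = - a then p3 else p23inv)" for a x
  have nonneg: "0 \<le> w a x" for a x
    using box by (simp add: w_def)
  have "(\<Sum>x\<in>UNIV. w a x) = 1" for a
    using card by (cases "a = 0") (simp_all add: w_def sum_if_one sum_if_two p1inv p23inv)
  then have "(\<integral>\<^sup>+x. ennreal (w a x) \<partial>count_space UNIV) = 1" for a
    by (simp add: nn_integral_count_space_finite sum_ennreal nonneg)
  then have "pmf (embed_pmf (w a)) x = w a x" for a x
    by (intro pmf_embed_pmf nonneg)
  then have "padding_kernel_with p1 p1inv p2 p3 p23inv (\<lambda>a. embed_pmf (w a))"
    using box p1inv p23inv by (auto simp: padding_kernel_with_def w_def)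
  then show ?thesis by blast
qed

lemma padding_kernel_with_inject:
  assumes "padding_kernel_with p1 p1inv p2 p3 p23inv V"
    and "padding_kernel_with p1 p1inv p2 p3 p23inv W"
  shows "V = W"
  by (intro ext pmf_eqI) (simp add: pmf_padding_kernel[OF assms(1)] pmf_padding_kernel[OF assms(2)])

section \<open>Minimizing the joint negative entropy in one variable\<close>

text \<open>The negative entropy of the joint law as a function of \<^term>\<open>t = p1 * s\<close>, the mass of
  \<open>(0, 0)\<close>, when \<^term>\<open>n\<close> is the number of nonzero field elements and \<^term>\<open>r\<close>, \<^term>\<open>u\<close> are the
  two sparsity levels.\<close>
definition joint_neg_entropy :: "real \<Rightarrow> real \<Rightarrow> real \<Rightarrow> real \<Rightarrow> real \<Rightarrow> real" where
  "joint_neg_entropy n s r u t = (let h = \<lambda>x. x * ln x in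
     h t + n * h ((s - t) / n) + n * h ((r - t) / n) + n * h ((u - t) / n)
       + n * (n - 1) * h ((1 - s - r - u + 2 * t) / (n * (n - 1))))"

text \<open>The tangent inequality at \<open>t0\<close> is summed over all cells. The cell masses
  are affine in \<open>t\<close>, so the tangents add up to an affine function of \<open>t\<close>,
  and \<open>crit\<close> says that its slope is zero.\<close>

lemma critical_point_unique_min:
  fixes n s r u t t0 :: real
  assumes n: "1 < n"
    and t: "0 \<le> t" "t \<le> s" "t \<le> r" "t \<le> u" "0 \<le> 1 - s - r - u + 2 * t"
    and t0: "0 < t0" "t0 < s" "t0 < r" "t0 < u" "0 < 1 - s - r - u + 2 * t0"
    and crit: "n * (t0 * (1 - s - r - u + 2 * t0)^2) = (n - 1)^2 * ((s - t0) * (r - t0) * (u - t0))"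
    and "t \<noteq> t0"
  shows "joint_neg_entropy n s r u t0 < joint_neg_entropy n s r u t"
proof -
  define h :: "real \<Rightarrow> real" where "h x = x * ln x" for x
  define F where "F = joint_neg_entropy n s r u"
  note F_simps = F_def joint_neg_entropy_def h_def Let_def
  define m where "m = n * (n - 1)"
  have m: "0 < m" using n by (simp add: m_def)
  define c where "c = 1 - s - r - u"
  define y1 y2 y3 y4 where "y1 = (s - t0) / n" and "y2 = (r - t0) / n" and "y3 = (u - t0) / n"
    and "y4 = (c + 2 * t0) / m"
  define x1 x2 x3 x4 where "x1 = (s - t) / n" and "x2 = (r - t) / n" and "x3 = (u - t) / n"
    and "x4 = (c + 2 * t) / m"
  have y: "0 < y1" "0 < y2" "0 < y3" "0 < y4"
    using t0 n m by (simp_all add: y1_def y2_def y3_def y4_def c_def)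
  have x: "0 \<le> x1" "0 \<le> x2" "0 \<le> x3" "0 \<le> x4"
    using t n m by (simp_all add: x1_def x2_def x3_def x4_def c_def)
  have nx: "n * x1 = s - t" "n * x2 = r - t" "n * x3 = u - t" "m * x4 = c + 2 * t"
    using n m by (simp_all add: x1_def x2_def x3_def x4_def)
  have ny: "n * y1 = s - t0" "n * y2 = r - t0" "n * y3 = u - t0" "m * y4 = c + 2 * t0"
    using n m by (simp_all add: y1_def y2_def y3_def y4_def)
  have "n * (t0 * (m * y4)^2) = (n - 1)^2 * ((n * y1) * (n * y2) * (n * y3))"
    using crit unfolding nx ny by (simp add: c_def)
  \<comment> \<open>In terms of masses of single cells the cardinality factors on both sides agree
    and cancel.\<close>
  then have "(n^3 * (n - 1)^2) * (t0 * y4^2) = (n^3 * (n - 1)^2) * (y1 * y2 * y3)"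
    unfolding m_def by algebra
  then have "t0 * y4^2 = y1 * y2 * y3" using n by simp
  then have "ln (t0 * y4^2) = ln (y1 * y2 * y3)" by simp
  then have lns: "ln t0 + 2 * ln y4 = ln y1 + ln y2 + ln y3"
    using y t0 by (simp add: ln_mult ln_realpow)
  have "(t * ln t0 + t - t0) + n * (x1 * ln y1 + x1 - y1) + n * (x2 * ln y2 + x2 - y2)
      + n * (x3 * ln y3 + x3 - y3) + m * (x4 * ln y4 + x4 - y4)
    < h t + n * h x1 + n * h x2 + n * h x3 + m * h x4"
    \<comment> \<open>Strictness comes from the first summand alone, where \<open>t\<close> differs
      from \<open>t0\<close>.\<close>
    unfolding h_def using n m x y t t0 \<open>t \<noteq> t0\<close>
    by (intro add_less_le_mono mult_left_mono xlnx_ge_tangent) simp_all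
  also have "\<dots> = F t"
    by (simp add: F_simps x1_def x2_def x3_def x4_def c_def m_def)
  also have "(t * ln t0 + t - t0) + n * (x1 * ln y1 + x1 - y1) + n * (x2 * ln y2 + x2 - y2)
      + n * (x3 * ln y3 + x3 - y3) + m * (x4 * ln y4 + x4 - y4)
    = t * ln t0 + (n * x1) * ln y1 + (n * x2) * ln y2 + (n * x3) * ln y3 + (m * x4) * ln y4
      + (t - t0 + (n * x1 - n * y1) + (n * x2 - n * y2) + (n * x3 - n * y3) + (m * x4 - m * y4))"
    by (simp add: algebra_simps)
  \<comment> \<open>The five group masses have slopes 1, -1, -1, -1 and 2 in \<open>t\<close>. These
    add up to zero, so the non-logarithmic corrections vanish and only the slope killed by
    \<open>lns\<close> remains.\<close>
  also have "\<dots> = t0 * ln t0 + (n * y1) * ln y1 + (n * y2) * ln y2 + (n * y3) * ln y3 + (m * y4) * ln y4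
      + (t - t0) * (ln t0 + 2 * ln y4 - (ln y1 + ln y2 + ln y3))"
    unfolding nx ny by (simp add: algebra_simps)
  also have "\<dots> = F t0"
    unfolding lns by (simp add: F_simps y1_def y2_def y3_def y4_def c_def m_def)
  finally show ?thesis unfolding F_def .
qed

text \<open>At \<open>L\<close> the left side vanishes, at \<open>U\<close> the right side does, so
  the intermediate value theorem gives a root. The left side is strictly increasing and the right
  side nonincreasing in between, so there is only one.\<close>

lemma critical_point_exists_unique:
  fixes c s r u \<theta> :: real
  defines "L \<equiv> max (- c / 2) 0" and "U \<equiv> Min {s, r, u}"
  assumes \<theta>: "0 < \<theta>" and "L \<le> U"
  shows "\<exists>!t. t * (c + 2 * t)^2 = \<theta> * ((s - t) * (r - t) * (u - t)) \<and> L \<le> t \<and> t \<le> U"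
proof (rule ex_ex1I)
  define g where "g t = t * (c + 2 * t)^2 - \<theta> * ((s - t) * (r - t) * (u - t))" for t
  have "L = 0 \<or> c + 2 * L = 0" by (auto simp: L_def max_def)
  moreover have "0 \<le> (s - L) * (r - L) * (u - L)"
    using \<open>L \<le> U\<close> by (auto simp: U_def)
  ultimately have "g L \<le> 0" using \<theta> by (auto simp: g_def)
  have "U = s \<or> U = r \<or> U = u" by (auto simp: U_def min_def)
  then have "0 \<le> g U"
    using \<open>L \<le> U\<close> by (auto simp: g_def L_def)
  have "continuous_on {L..U} g"
    unfolding g_def by (intro continuous_intros)
  with \<open>g L \<le> 0\<close> \<open>0 \<le> g U\<close> \<open>L \<le> U\<close> obtain t where "L \<le> t" "t \<le> U" "g t = 0"
    using IVT'[of g L 0 U] by blast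
  then show "\<exists>t. t * (c + 2 * t)^2 = \<theta> * ((s - t) * (r - t) * (u - t)) \<and> L \<le> t \<and> t \<le> U"
    by (auto simp: g_def)
next
  have less: False
    if t: "t * (c + 2 * t)^2 = \<theta> * ((s - t) * (r - t) * (u - t)) \<and> L \<le> t \<and> t \<le> U"
      and v: "v * (c + 2 * v)^2 = \<theta> * ((s - v) * (r - v) * (u - v)) \<and> L \<le> v \<and> v \<le> U"
      and "t < v" for t v
  proof -
    have "0 \<le> t" "0 \<le> c + 2 * t" using t by (auto simp: L_def)
    then have "t * (c + 2 * t)^2 < v * (c + 2 * v)^2"
      using \<open>t < v\<close> by (intro mult_strict_mono power_strict_mono) auto
    moreover have "(s - v) * (r - v) * (u - v) \<le> (s - t) * (r - t) * (u - t)"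
      using \<open>t < v\<close> t v by (intro mult_mono) (auto simp: U_def)
    ultimately show False using t v \<theta> by (smt (verit) mult_left_mono)
  qed
  fix t v
  assume "t * (c + 2 * t)^2 = \<theta> * ((s - t) * (r - t) * (u - t)) \<and> L \<le> t \<and> t \<le> U"
    and "v * (c + 2 * v)^2 = \<theta> * ((s - v) * (r - v) * (u - v)) \<and> L \<le> v \<and> v \<le> U"
  then show "t = v" using less[of t v] less[of v t] by (metis linorder_neqE_linordered_idom)
qed

text \<open>At an endpoint of the feasible interval one side of the equation vanishes, and it is only
  at a one-point interval that both do.\<close>
lemma critical_point_interior:
  fixes c s r u \<theta> t v :: real
  assumes \<theta>: "0 < \<theta>"
    and crit: "t * (c + 2 * t)^2 = \<theta> * ((s - t) * (r - t) * (u - t))"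
    and t: "0 \<le> t" "0 \<le> c + 2 * t" "t \<le> s" "t \<le> r" "t \<le> u"
    and v: "0 \<le> v" "0 \<le> c + 2 * v" "v \<le> s" "v \<le> r" "v \<le> u"
    and "v \<noteq> t"
  shows "0 < t \<and> 0 < c + 2 * t \<and> t < s \<and> t < r \<and> t < u"
\<comment> \<open>A feasible \<open>v\<close> below \<open>t\<close> makes the left side of
  \<open>crit\<close> positive, so no factor on the right vanishes; a feasible \<open>v\<close>
  above \<open>t\<close> makes the right side positive, so no factor on the left vanishes.\<close>
proof (cases "v < t")
  case True
  then have "0 < t * (c + 2 * t)^2" using v by simp
  then have "(s - t) * (r - t) * (u - t) \<noteq> 0" using crit by auto
  then show ?thesis using True t v by auto
next
  case False
  then have "0 < \<theta> * ((s - t) * (r - t) * (u - t))" using v \<theta> \<open>v \<noteq> t\<close> by simp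
  then have "t * (c + 2 * t)^2 \<noteq> 0" using crit by auto
  then show ?thesis using False t v \<open>v \<noteq> t\<close> by auto
qed

section \<open>The leakage as a function of the mass of \<open>(0, 0)\<close>\<close>

text \<open>Once \<open>r\<close> and \<open>u\<close> are fixed, \<open>R\<close> and
  \<open>A + R\<close> are uniform off zero with known mass at zero, so only the joint entropy still
  depends on \<open>p1\<close>.\<close>

lemma total_leakage_padding_kernel:
  fixes A :: "'f::{field,finite} pmf" and h :: "real \<Rightarrow> real"
  defines "n \<equiv> real CARD('f) - 1" and "h \<equiv> \<lambda>x. x * ln x"
  assumes A: "private_entry_law s A"
    and W: "padding_kernel_with p1 p1inv p2 p3 p23inv W"
    and r: "p1 * s + p2 * (1 - s) = r" and u: "p1 * s + p3 * (1 - s) = u"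
    and card: "3 \<le> CARD('f)"
  shows "total_leakage A W =
    (2 * joint_neg_entropy n s r u (p1 * s) - 2 * neg_entropy A
      - (h r + n * h ((1 - r) / n)) - (h u + n * h ((1 - u) / n))) / ln (real CARD('f))"
proof -
  have card2: "2 \<le> CARD('f)" using card by simp
  have n: "1 < n" using card by (simp add: n_def)
  have N: "real CARD('f) - 2 = n - 1" by (simp add: n_def)
  have p1inv: "p1inv = (1 - p1) / n" and p23inv: "(n - 1) * p23inv = 1 - p2 - p3"
    using W card by (auto simp: padding_kernel_with_def n_def)
  have q: "s * p1inv = (s - p1 * s) / n" "(1 - s) / n * p2 = (r - p1 * s) / n"
     "(1 - s) / n * p3 = (u - p1 * s) / n"
    using n r u by (auto simp: p1inv field_simps)
  \<comment> \<open>The mass \<open>(1 - s) * (1 - p2 - p3)\<close>, with \<open>p2\<close> and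
    \<open>p3\<close> eliminated through the sparsity equations, is shared by
    \<open>n * (n - 1)\<close> cells.\<close>
  have q4: "(1 - s) / n * p23inv = (1 - s - r - u + 2 * (p1 * s)) / (n * (n - 1))"
  proof -
    have "(1 - s) * ((n - 1) * p23inv) = 1 - s - r - u + 2 * (p1 * s)"
      unfolding p23inv r[symmetric] u[symmetric] by (simp add: algebra_simps)
    moreover have "(1 - s) / n * p23inv = (1 - s) * ((n - 1) * p23inv) / (n * (n - 1))"
      using n by simp
    ultimately show ?thesis by (simp only:)
  qed
  have "s * p1inv + (1 - s) / n * (p3 + (n - 1) * p23inv) = (s * (1 - p1) + (1 - s) * (1 - p2)) / n"
    unfolding p1inv p23inv by (simp add: add_divide_distrib)
  also have "\<dots> = (1 - r) / n" unfolding r[symmetric] by (simp add: algebra_simps)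
  finally have "pmf (map_pmf snd (joint_pmf A W)) x = (if x = 0 then r else (1 - r) / n)" for x
    using r unfolding pmf_map_snd_joint[OF A W card2] N n_def[symmetric] by (auto simp: mult.commute)
  then have R: "neg_entropy (map_pmf snd (joint_pmf A W)) = h r + n * h ((1 - r) / n)"
    unfolding h_def n_def by (intro neg_entropy_two_values) (simp add: n_def)
  have "s * p1inv + (1 - s) / n * (p2 + (n - 1) * p23inv) = (s * (1 - p1) + (1 - s) * (1 - p3)) / n"
    unfolding p1inv p23inv by (simp add: add_divide_distrib)
  also have "\<dots> = (1 - u) / n" unfolding u[symmetric] by (simp add: algebra_simps)
  finally have "pmf (map_pmf (\<lambda>(a, x). a + x) (joint_pmf A W)) y
      = (if y = 0 then u else (1 - u) / n)" for y
    using u unfolding pmf_map_plus_joint[OF A W card2] N n_def[symmetric] by (auto simp: mult.commute)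
  then have AR: "neg_entropy (map_pmf (\<lambda>(a, x). a + x) (joint_pmf A W)) = h u + n * h ((1 - u) / n)"
    unfolding h_def n_def by (intro neg_entropy_two_values) (simp add: n_def)
  have "neg_entropy (joint_pmf A W) = joint_neg_entropy n s r u (p1 * s)"
    unfolding neg_entropy_joint_padding[OF A W] n_def[symmetric] q q4 joint_neg_entropy_def Let_def
    by (simp add: mult.commute[of s] distrib_left)
  then show ?thesis
    unfolding total_leakage_neg_entropy[OF card2] R AR by simp
qed

section \<open>The one-parameter family of admissible kernels and its unique minimizer\<close>

theorem theorem1:
  fixes A :: "'f::{field,finite} pmf"
    and q :: nat
    and s sR sAR \<theta> \<alpha> \<beta> \<gamma> \<delta> :: real
  assumes "q = CARD('f)" and "q \<ge> 3"
    and "1 / real q < s" and "s < 1"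
    and "private_entry_law s A"
    and "sR \<in> {1 / real q<..1}" and "sAR \<in> {1 / real q<..1}"
    and "\<exists>W. padding_kernel W \<and> attains_sparsity A sR sAR W"
    and "\<theta> = (real q - 2)^2 / (real q - 1)"
    and "\<alpha> = s^2 * (4 + \<theta>)"
    and "\<beta> = 4 * s * (1 - s - sAR - sR) - \<theta> * s * (sR + sAR + s)"
    and "\<gamma> = (1 - s - sAR - sR)^2 + \<theta> * (s * sAR + s * sR + sAR * sR)"
    and "\<delta> = - \<theta> * sAR * sR"
  shows "\<exists>p1 p1inv p2 p3 p23inv W.
    (\<forall>p. \<alpha> * p^3 + \<beta> * p^2 + \<gamma> * p + \<delta> = 0 \<and>
         max (sR + sAR - 1 + s) 0 \<le> 2 * p * s \<and>
         2 * p * s \<le> 2 * Min {s, sR, sAR} \<longleftrightarrow> p = p1) \<and>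
    (\<forall>y1 y2 y3 y23.
         p1 + (real q - 1) * y1 = 1 \<and>
         y2 + y3 + (real q - 2) * y23 = 1 \<and>
         p1 * s + y2 * (1 - s) = sR \<and>
         p1 * s + y3 * (1 - s) = sAR \<longleftrightarrow>
         (y1, y2, y3, y23) = (p1inv, p2, p3, p23inv)) \<and>
    padding_kernel_with p1 p1inv p2 p3 p23inv W \<and>
    (\<forall>V. is_arg_min (total_leakage A)
           (\<lambda>V. padding_kernel V \<and> attains_sparsity A sR sAR V) V \<longleftrightarrow> V = W)"
proof -
  define n where "n = real q - 1"
  define c where "c = 1 - s - sR - sAR"
  define p1inv :: "real \<Rightarrow> real" where "p1inv p = (1 - p) / n" for p
  define p2 where "p2 p = (sR - p * s) / (1 - s)" for p
  define p3 where "p3 p = (sAR - p * s) / (1 - s)" for p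
  define p23inv where "p23inv p = (1 - p2 p - p3 p) / (n - 1)" for p
  define kernel :: "real \<Rightarrow> ('f \<Rightarrow> 'f pmf) \<Rightarrow> bool" where
    "kernel p = padding_kernel_with p (p1inv p) (p2 p) (p3 p) (p23inv p)" for p
  \<comment> \<open>With \<open>t = p1 * s\<close>, these inequalities say that the masses of all
    five kinds of cells are nonnegative.\<close>
  define feasible where
    "feasible t \<longleftrightarrow> 0 \<le> t \<and> 0 \<le> c + 2 * t \<and> t \<le> s \<and> t \<le> sR \<and> t \<le> sAR" for t
  have n: "1 < n" "2 \<le> n" "real CARD('f) - 1 = n" "real CARD('f) - 2 = n - 1"
    using assms(1,2) by (simp_all add: n_def)
  have card: "3 \<le> CARD('f)" "2 \<le> CARD('f)" using assms(1,2) by simp_all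
  have "0 \<le> 1 / real q" by simp
  then have s: "0 < s" "s < 1" using assms(3,4) by linarith+
  have \<theta>: "\<theta> = (n - 1)^2 / n" using assms(9) by (simp add: n_def)
  then have "0 < \<theta>" using n by simp

  have linear: "p * s + y2 * (1 - s) = sR \<longleftrightarrow> y2 = p2 p"
    "p * s + y3 * (1 - s) = sAR \<longleftrightarrow> y3 = p3 p"
    "p + n * y1 = 1 \<longleftrightarrow> y1 = p1inv p" for p y1 y2 y3
    using s n by (auto simp: p2_def p3_def p1inv_def field_simps)
  \<comment> \<open>The sparsity and normalization equations leave \<open>p1\<close> as the only
    free parameter.\<close>
  have admissible: "padding_kernel V \<and> attains_sparsity A sR sAR V \<longleftrightarrow> (\<exists>p. kernel p V)" for V
  proof
    assume V: "padding_kernel V \<and> attains_sparsity A sR sAR V"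
    then obtain p y1 y2 y3 y23 where k: "padding_kernel_with p y1 y2 y3 y23 V"
      by (auto simp: padding_kernel_def)
    have "y2 = p2 p" "y3 = p3 p"
      using V attains_sparsity_padding_kernel[OF assms(5) k card(2)] linear by auto
    moreover have "y1 = p1inv p" "y23 = (1 - y2 - y3) / (n - 1)"
      using k n by (simp_all add: padding_kernel_with_def p1inv_def)
    ultimately show "\<exists>p. kernel p V"
      using k by (auto simp: kernel_def p23inv_def)
  next
    assume "\<exists>p. kernel p V"
    then obtain p where k: "kernel p V" ..
    then have "padding_kernel V" unfolding kernel_def padding_kernel_def by blast
    then show "padding_kernel V \<and> attains_sparsity A sR sAR V"
      using attains_sparsity_padding_kernel[OF assms(5) k[unfolded kernel_def] card(2)] linear
      by auto
  qed
  have one_minus: "1 - p2 p - p3 p = (c + 2 * (p * s)) / (1 - s)" for p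
  proof -
    have "p2 p * (1 - s) = sR - p * s" "p3 p * (1 - s) = sAR - p * s"
      using s by (simp_all add: p2_def p3_def)
    then have "(1 - p2 p - p3 p) * (1 - s) = c + 2 * (p * s)"
      by (simp add: left_diff_distrib c_def)
    then show ?thesis using s by (simp add: eq_divide_eq)
  qed
  have feasible_iff: "(\<exists>V. kernel p V) \<longleftrightarrow> feasible (p * s)" for p
  proof
    assume "\<exists>V. kernel p V"
    then have "0 \<le> p" "p \<le> 1" "0 \<le> p2 p" "0 \<le> p3 p" "0 \<le> p23inv p"
      by (auto simp: kernel_def padding_kernel_with_def)
    moreover from this have "0 \<le> 1 - p2 p - p3 p"
      using n by (simp add: p23inv_def zero_le_divide_iff)
    ultimately show "feasible (p * s)"
      using s unfolding one_minus
      by (simp add: feasible_def p2_def p3_def zero_le_divide_iff mult_left_le_one_le)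
  next
    assume f: "feasible (p * s)"
    then have p: "0 \<le> p" "p \<le> 1" using s by (auto simp: feasible_def zero_le_mult_iff)
    have "0 \<le> p2 p" "0 \<le> p3 p" "0 \<le> 1 - p2 p - p3 p"
      using f s unfolding one_minus by (simp_all add: feasible_def p2_def p3_def)
    moreover from this have "0 \<le> p23inv p" using n by (simp add: p23inv_def)
    \<comment> \<open>The numerator is at most 1 and the denominator \<open>n - 1\<close> is at
      least 1.\<close>
    moreover have "p23inv p \<le> 1"
      using \<open>0 \<le> p2 p\<close> \<open>0 \<le> p3 p\<close> n by (simp add: p23inv_def divide_le_eq_1)
    moreover have "0 \<le> p1inv p" "p1inv p \<le> 1" using p n by (simp_all add: p1inv_def)
    ultimately show "\<exists>V. kernel p V"
      unfolding kernel_def using p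
      by (intro exists_padding_kernel card) (auto simp: p1inv_def p23inv_def n)
  qed

  define crit where "crit t \<longleftrightarrow> t * (c + 2 * t)^2 = \<theta> * ((s - t) * (sR - t) * (sAR - t))" for t
  have bounds: "feasible t \<longleftrightarrow> max (- c / 2) 0 \<le> t \<and> t \<le> Min {s, sR, sAR}" for t
    by (auto simp: feasible_def)
  \<comment> \<open>The kernel assumed to attain the sparsity levels shows that the feasible
    interval is nonempty.\<close>
  obtain V0 where "padding_kernel V0 \<and> attains_sparsity A sR sAR V0"
    using assms(8) by blast
  then obtain v where v: "feasible (v * s)" using admissible feasible_iff by blast
  then have "max (- c / 2) 0 \<le> Min {s, sR, sAR}" unfolding bounds by linarith
  from critical_point_exists_unique[OF \<open>0 < \<theta>\<close> this]
  obtain t0 where t0: "crit t \<and> feasible t \<longleftrightarrow> t = t0" for t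
    unfolding crit_def bounds by metis
  define p0 where "p0 = t0 / s"
  have p0: "p0 * s = t0" using s by (simp add: p0_def)
  have feas0: "feasible t0" and crit0: "crit t0" using t0 by blast+
  then obtain W where W: "kernel p0 W" using feasible_iff p0 by metis

  have root: "\<alpha> * p^3 + \<beta> * p^2 + \<gamma> * p + \<delta> = 0 \<and> max (sR + sAR - 1 + s) 0 \<le> 2 * p * s \<and>
      2 * p * s \<le> 2 * Min {s, sR, sAR} \<longleftrightarrow> p = p0" for p
  proof -
    have "s * (\<alpha> * p^3 + \<beta> * p^2 + \<gamma> * p + \<delta>)
      = p * s * (c + 2 * (p * s))^2 - \<theta> * ((s - p * s) * (sR - p * s) * (sAR - p * s))"
      unfolding assms(10-13) c_def by algebra
    then have "\<alpha> * p^3 + \<beta> * p^2 + \<gamma> * p + \<delta> = 0 \<longleftrightarrow> crit (p * s)"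
      unfolding crit_def using s
      by (metis eq_iff_diff_eq_0 mult_eq_0_iff less_irrefl)
    \<comment> \<open>Since \<open>sR + sAR - 1 + s = - c\<close>, the stated range is the feasible
      interval scaled by 2.\<close>
    moreover have "max (sR + sAR - 1 + s) 0 \<le> 2 * p * s \<and> 2 * p * s \<le> 2 * Min {s, sR, sAR}
        \<longleftrightarrow> feasible (p * s)"
      by (auto simp: feasible_def c_def)
    moreover have "p * s = t0 \<longleftrightarrow> p = p0" using s p0 by auto
    ultimately show ?thesis using t0 by metis
  qed

  \<comment> \<open>\<open>K\<close> collects the entropies of \<open>A\<close>, \<open>R\<close>
    and \<open>A + R\<close>, which are the same for all admissible kernels.\<close>
  define K where "K = 2 * neg_entropy A
      + (sR * ln sR + n * ((1 - sR) / n * ln ((1 - sR) / n)))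
      + (sAR * ln sAR + n * ((1 - sAR) / n * ln ((1 - sAR) / n)))"
  have kernel_leakage: "total_leakage A V
      = (2 * joint_neg_entropy n s sR sAR (p * s) - K) / ln (real CARD('f))"
    if "kernel p V" for p V
    unfolding total_leakage_padding_kernel[OF assms(5) that[unfolded kernel_def]
        linear(1)[THEN iffD2, OF refl] linear(2)[THEN iffD2, OF refl] card(1)] K_def n(3)
    by (simp only: diff_diff_eq)
  have leakage: "total_leakage A W < total_leakage A V" if V: "kernel p V" and "p \<noteq> p0" for p V
  proof -
    have "feasible (p * s)" using V feasible_iff by blast
    have "p * s \<noteq> t0" using \<open>p \<noteq> p0\<close> p0 s by auto
    \<comment> \<open>The competitor supplies a second feasible point, which forces
      \<open>t0\<close> into the interior, where all logarithms have positive arguments.\<close>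
    have int: "0 < t0 \<and> 0 < c + 2 * t0 \<and> t0 < s \<and> t0 < sR \<and> t0 < sAR"
      using critical_point_interior[OF \<open>0 < \<theta>\<close> crit0[unfolded crit_def], of "p * s"]
        feas0 \<open>feasible (p * s)\<close> \<open>p * s \<noteq> t0\<close> unfolding feasible_def by blast
    have "n * (t0 * (c + 2 * t0)^2) = (n - 1)^2 * ((s - t0) * (sR - t0) * (sAR - t0))"
      using crit0 n by (simp add: crit_def \<theta>)
    then have "joint_neg_entropy n s sR sAR t0 < joint_neg_entropy n s sR sAR (p * s)"
      using \<open>feasible (p * s)\<close> int \<open>p * s \<noteq> t0\<close> n
      by (intro critical_point_unique_min) (auto simp: feasible_def c_def)
    moreover have "0 < ln (real CARD('f))" using card by simp
    ultimately show ?thesis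
      unfolding kernel_leakage[OF V] kernel_leakage[OF W] p0
      by (intro divide_strict_right_mono) linarith+
  qed
  have same: "V = W" if "kernel p0 V" for V
    using that W padding_kernel_with_inject unfolding kernel_def by blast
  \<comment> \<open>An admissible kernel other than \<open>W\<close> has \<open>p\<close> different
    from \<open>p0\<close> and hence strictly larger leakage. If the feasible interval is one point,
    \<open>W\<close> is the only candidate.\<close>
  have minimizer: "is_arg_min (total_leakage A)
       (\<lambda>V. padding_kernel V \<and> attains_sparsity A sR sAR V) V \<longleftrightarrow> V = W" for V
    unfolding is_arg_min_def admissible
    using leakage same W by (metis less_asym)
  have "p0 + n * y1 = 1 \<and> y2 + y3 + (n - 1) * y23 = 1 \<and>
      p0 * s + y2 * (1 - s) = sR \<and> p0 * s + y3 * (1 - s) = sAR \<longleftrightarrow>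
      (y1, y2, y3, y23) = (p1inv p0, p2 p0, p3 p0, p23inv p0)" for y1 y2 y3 y23
  proof -
    have "y2 + y3 + (n - 1) * y23 = 1 \<longleftrightarrow> y23 = (1 - y2 - y3) / (n - 1)"
      using n by (auto simp: field_simps)
    then show ?thesis unfolding linear p23inv_def by auto
  qed
  moreover have q: "real q - 1 = n" "real q - 2 = n - 1" by (simp_all add: n_def)
  ultimately show ?thesis
    unfolding q
    by (intro exI[of _ p0] exI[of _ "p1inv p0"] exI[of _ "p2 p0"] exI[of _ "p3 p0"]
        exI[of _ "p23inv p0"] exI[of _ W] conjI allI root minimizer W[unfolded kernel_def])
qed

end
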